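(* Let $(C,\bar\xi)$ be a versor field in a Myller configuration with Frenet-type frame $R_F=\{P(s);\bar\xi_1,\bar\xi_2,\bar\xi_3\}$ and (nowhere) non-zero curvatures $K_1,K_2$. Then $\bar\xi_1$ satisfies the differential equation $$\bar\xi_1'''-\left[\frac{(K_1K_2)'}{K_1K_2}+\frac{K_1'}{K_1}\right]\bar\xi_1''+\left\{K_1K_2\left[\frac1{K_2}\left(\frac1{K_1}\right)'\right]'+K_1^2+K_2^2\right\}\bar\xi_1'+K_1K_2\left(\frac{K_1}{K_2}\right)'\bar\xi_1=0.$$
   Context: All data are smooth. Let $C$ be a curve in Euclidean space $E^3$ with arclength parameter $s\in I$ ($I$ an interval) and position vector $\bar r(s)$, let $\bar\xi(s)$ be a unit vector field along $C$ (a versor field $(C,\bar\xi)$), and let $\pi(s)$ be a plane field along $C$ with $\bar\xi(s)\in\pi(s)$. The pair $((C,\bar\xi),(C,\pi))$ is called a Myller configuration $M=M(C,\bar\xi,\pi)$. Put $\bar\xi_1=\bar\xi$, $K_1=\|d\bar\xi/ds\|>0$ (curvature), define $\bar\xi_2$ by $\bar\xi_1'=K_1\bar\xi_2$, and $\bar\xi_3=\bar\xi_1\times\bar\xi_2$. Then $R_F=\{P(s);\bar\xi_1,\bar\xi_2,\bar\xi_3\}$ is a positively oriented orthonormal frame, the Frenet-type frame, and $$\bar\xi_1'=K_1\bar\xi_2,\quad \bar\xi_2'=-K_1\bar\xi_1+K_2\bar\xi_3,\quad \bar\xi_3'=-K_2\bar\xi_2,$$ which defines the torsion $K_2$. A prime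 denotes $d/ds$. *)

theory Defs
  imports "HOL-Analysis.Analysis"
begin

unbundle cross3_syntax

text \<open>
  Derivatives along an interval \<open>I\<close> are taken within \<open>I\<close>, so they are one-sided at an endpoint
  belonging to \<open>I\<close> and do not depend on junk values outside \<open>I\<close>. Iterating the operator gives
  the higher derivatives; real-valued functions are covered as well.
\<close>

definition deriv_along :: "real set \<Rightarrow> (real \<Rightarrow> 'a::real_normed_vector) \<Rightarrow> real \<Rightarrow> 'a" where
  "deriv_along I f = (\<lambda>s. vector_derivative f (at s within I))"

definition smooth_along :: "real set \<Rightarrow> (real \<Rightarrow> 'a::real_normed_vector) \<Rightarrow> bool" where
  "smooth_along I f \<longleftrightarrow> (\<forall>n. (deriv_along I ^^ n) f differentiable_on I)"

text \<open>Non-empty interior only excludes the empty and one-point intervals.\<close>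

definition arclength_curve :: "real set \<Rightarrow> (real \<Rightarrow> real^3) \<Rightarrow> bool" where
  "arclength_curve I r \<longleftrightarrow>
     is_interval I \<and> interior I \<noteq> {} \<and> smooth_along I r \<and> (\<forall>s\<in>I. norm (deriv_along I r s) = 1)"

definition versor_field :: "real set \<Rightarrow> (real \<Rightarrow> real^3) \<Rightarrow> bool" where
  "versor_field I \<xi> \<longleftrightarrow> smooth_along I \<xi> \<and> (\<forall>s\<in>I. norm (\<xi> s) = 1)"

text \<open>
  The plane \<open>\<pi> s\<close> is represented by its two-dimensional space of directions at the point \<open>r s\<close>.
  Smoothness of the field means that it has a smooth unit normal; on an interval this can be
  chosen globally.
\<close>

definition plane_field :: "real set \<Rightarrow> (real \<Rightarrow> (real^3) set) \<Rightarrow> bool" where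
  "plane_field I \<pi> \<longleftrightarrow> (\<exists>\<nu>. versor_field I \<nu> \<and> (\<forall>s\<in>I. \<pi> s = {v. \<nu> s \<bullet> v = 0}))"

definition myller_configuration ::
  "real set \<Rightarrow> (real \<Rightarrow> real^3) \<Rightarrow> (real \<Rightarrow> real^3) \<Rightarrow> (real \<Rightarrow> (real^3) set) \<Rightarrow> bool" where
  "myller_configuration I r \<xi> \<pi> \<longleftrightarrow>
     arclength_curve I r \<and> versor_field I \<xi> \<and> plane_field I \<pi> \<and> (\<forall>s\<in>I. \<xi> s \<in> \<pi> s)"

definition curvature1 :: "real set \<Rightarrow> (real \<Rightarrow> real^3) \<Rightarrow> real \<Rightarrow> real" where
  "curvature1 I \<xi> s = norm (deriv_along I \<xi> s)"

definition frenet2 :: "real set \<Rightarrow> (real \<Rightarrow> real^3) \<Rightarrow> real \<Rightarrow> real^3" where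
  "frenet2 I \<xi> s = (1 / curvature1 I \<xi> s) *\<^sub>R deriv_along I \<xi> s"

definition frenet3 :: "real set \<Rightarrow> (real \<Rightarrow> real^3) \<Rightarrow> real \<Rightarrow> real^3" where
  "frenet3 I \<xi> s = \<xi> s \<times> frenet2 I \<xi> s"

text \<open>
  The torsion is the coefficient determined by the Frenet-type equations; the description is
  meaningful wherever the curvature does not vanish along \<open>I\<close>, see \<open>frenet_equations\<close> below.
\<close>

definition curvature2 :: "real set \<Rightarrow> (real \<Rightarrow> real^3) \<Rightarrow> real \<Rightarrow> real" where
  "curvature2 I \<xi> s = (THE k.
     deriv_along I (frenet2 I \<xi>) s = - curvature1 I \<xi> s *\<^sub>R \<xi> s + k *\<^sub>R frenet3 I \<xi> s \<and>
     deriv_along I (frenet3 I \<xi>) s = - k *\<^sub>R frenet2 I \<xi> s)"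

lemma within_interval_nontrivial:
  fixes I :: "real set"
  assumes "is_interval I" "interior I \<noteq> {}" "s \<in> I"
  shows "at s within I \<noteq> bot"
proof -
  have "I \<noteq> {s}" using assms(2) by auto
  then have "s islimpt I"
    using connected_imp_perfect[of I s] assms by (auto simp: is_interval_connected)
  then show ?thesis by (simp add: trivial_limit_within)
qed

lemma deriv_alongI:
  assumes "is_interval I" "interior I \<noteq> {}" "s \<in> I" "(f has_vector_derivative d) (at s within I)"
  shows "deriv_along I f s = d"
  unfolding deriv_along_def
  using within_interval_nontrivial[OF assms(1-3)] assms(4) by (rule vector_derivative_within)

lemma smooth_along_has_derivative:
  assumes "smooth_along I f" "s \<in> I"
  shows "((deriv_along I ^^ n) f has_vector_derivative (deriv_along I ^^ Suc n) f s) (at s within I)"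
  using assms by (simp add: smooth_along_def differentiable_on_def deriv_along_def
      vector_derivative_works[symmetric])

lemma has_vector_derivative_inner:
  fixes f g :: "real \<Rightarrow> 'a::real_inner"
  assumes "(f has_vector_derivative f') (at s within I)" "(g has_vector_derivative g') (at s within I)"
  shows "((\<lambda>t. f t \<bullet> g t) has_vector_derivative (f s \<bullet> g' + f' \<bullet> g s)) (at s within I)"
  using bounded_bilinear.has_vector_derivative[OF bounded_bilinear_inner assms] .

lemma constant_has_derivative_0:
  assumes "is_interval I" "interior I \<noteq> {}" "s \<in> I"
    and "(f has_vector_derivative d) (at s within I)" and "\<And>t. t \<in> I \<Longrightarrow> f t = c"
  shows "d = 0"
proof -
  have "(f has_vector_derivative 0) (at s within I)"
    by (rule has_vector_derivative_transform[of s I f "\<lambda>_. c"]) (use assms in auto)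
  then show ?thesis
    using deriv_alongI[OF assms(1-3)] assms(4) by metis
qed

lemma orthonormal_triple_expand:
  fixes a b v :: "real^3"
  assumes "a \<bullet> a = 1" "b \<bullet> b = 1" "a \<bullet> b = 0"
  shows "v = (v \<bullet> a) *\<^sub>R a + (v \<bullet> b) *\<^sub>R b + (v \<bullet> (a \<times> b)) *\<^sub>R (a \<times> b)"
    and "a \<times> (a \<times> b) = - b" and "(a \<times> b) \<bullet> (a \<times> b) = 1"
proof -
  have L: "x \<times> (y \<times> z) = (x \<bullet> z) *\<^sub>R y - (x \<bullet> y) *\<^sub>R z" for x y z :: "real^3"
    by (simp add: cross3_simps) (auto simp: forall_3 algebra_simps)
  show ab: "a \<times> (a \<times> b) = - b" using L[of a a b] assms by simp
  show 1: "(a \<times> b) \<bullet> (a \<times> b) = 1"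
    using norm_cross_dot[of a b] assms by (simp add: norm_eq_sqrt_inner)
  let ?w = "v - ((v \<bullet> a) *\<^sub>R a + (v \<bullet> b) *\<^sub>R b + (v \<bullet> (a \<times> b)) *\<^sub>R (a \<times> b))"
  have o: "?w \<bullet> a = 0" "?w \<bullet> b = 0" "?w \<bullet> (a \<times> b) = 0"
    using assms 1 by (auto simp: inner_diff_left inner_add_left dot_cross_self inner_commute[of b a])
  have "?w \<times> (a \<times> b) = 0" using L[of ?w a b] o by simp
  then have "norm ?w * norm (a \<times> b) = 0"
    using norm_cross_dot[of ?w "a \<times> b"] o(3) by simp
  then have "?w = 0" using 1 by auto
  then show "v = (v \<bullet> a) *\<^sub>R a + (v \<bullet> b) *\<^sub>R b + (v \<bullet> (a \<times> b)) *\<^sub>R (a \<times> b)"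
    by simp
qed

lemma frenet_equations:
  assumes I: "is_interval I" "interior I \<noteq> {}" and \<xi>: "versor_field I \<xi>"
    and K: "\<And>s. s \<in> I \<Longrightarrow> curvature1 I \<xi> s \<noteq> 0" and s: "s \<in> I"
  shows "deriv_along I \<xi> s = curvature1 I \<xi> s *\<^sub>R frenet2 I \<xi> s"
    and "deriv_along I (frenet2 I \<xi>) s =
           - curvature1 I \<xi> s *\<^sub>R \<xi> s + curvature2 I \<xi> s *\<^sub>R frenet3 I \<xi> s"
    and "deriv_along I (frenet3 I \<xi>) s = - curvature2 I \<xi> s *\<^sub>R frenet2 I \<xi> s"
proof -
  let ?D = "deriv_along I" and ?e2 = "frenet2 I \<xi>" and ?e3 = "frenet3 I \<xi>"
  let ?K = "curvature1 I \<xi>"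
  have sm: "smooth_along I \<xi>" and un: "\<And>t. t \<in> I \<Longrightarrow> \<xi> t \<bullet> \<xi> t = 1"
    using \<xi> by (auto simp: versor_field_def norm_eq_1)
  have d1: "(\<xi> has_vector_derivative ?D \<xi> t) (at t within I)" if "t \<in> I" for t
    using smooth_along_has_derivative[OF sm that, of 0] by simp
  have e1: "?D \<xi> t = ?K t *\<^sub>R ?e2 t" if "t \<in> I" for t
    using K[OF that] by (simp add: frenet2_def)
  show "?D \<xi> s = ?K s *\<^sub>R ?e2 s" using e1 s .
  have n2: "?e2 t \<bullet> ?e2 t = 1" if "t \<in> I" for t
    using K[OF that] by (simp add: frenet2_def curvature1_def dot_square_norm power2_eq_square)
  have o12: "\<xi> t \<bullet> ?e2 t = 0" if "t \<in> I" for t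
  proof -
    have "\<xi> t \<bullet> ?D \<xi> t + ?D \<xi> t \<bullet> \<xi> t = 0"
      by (rule constant_has_derivative_0[OF I that has_vector_derivative_inner[OF d1 d1]])
         (use that un in auto)
    then show ?thesis by (simp add: frenet2_def inner_commute)
  qed
  have "?e2 differentiable (at s within I)"
  proof -
    have 1: "?D \<xi> differentiable (at s within I)"
      using smooth_along_has_derivative[OF sm s, of 1]
      by (auto simp: has_vector_derivative_def differentiable_def)
    have "?D \<xi> s \<noteq> 0" using K[OF s] by (auto simp: curvature1_def)
    then have "(\<lambda>t. norm (?D \<xi> t)) differentiable (at s within I)"
      using differentiable_chain_within[OF 1, of norm] differentiable_norm_at
      by (auto simp: o_def intro: differentiable_at_withinI)
    then have "(\<lambda>t. inverse (norm (?D \<xi> t)) *\<^sub>R ?D \<xi> t) differentiable (at s within I)"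
      using 1 \<open>?D \<xi> s \<noteq> 0\<close> by (intro differentiable_scaleR differentiable_inverse) auto
    then show ?thesis by (simp add: frenet2_def[abs_def] curvature1_def divide_inverse)
  qed
  then have d2: "(?e2 has_vector_derivative ?D ?e2 s) (at s within I)"
    by (simp add: deriv_along_def vector_derivative_works)
  have a2: "?D ?e2 s \<bullet> ?e2 s = 0"
  proof -
    have "?e2 s \<bullet> ?D ?e2 s + ?D ?e2 s \<bullet> ?e2 s = 0"
      by (rule constant_has_derivative_0[OF I s has_vector_derivative_inner[OF d2 d2]])
         (use n2 in auto)
    then show ?thesis by (simp add: inner_commute)
  qed
  have a1: "?D ?e2 s \<bullet> \<xi> s = - ?K s"
  proof -
    have "\<xi> s \<bullet> ?D ?e2 s + ?D \<xi> s \<bullet> ?e2 s = 0"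
      by (rule constant_has_derivative_0[OF I s has_vector_derivative_inner[OF d1[OF s] d2]])
         (use o12 in auto)
    then show ?thesis using e1[OF s] n2[OF s] by (simp add: inner_commute)
  qed
  define k where "k = ?D ?e2 s \<bullet> ?e3 s"
  note T = orthonormal_triple_expand[OF un[OF s] n2[OF s] o12[OF s], folded frenet3_def]
  have f2: "?D ?e2 s = - ?K s *\<^sub>R \<xi> s + k *\<^sub>R ?e3 s"
    using T(1)[of "?D ?e2 s"] a1 a2 by (simp add: k_def)
  have "(?e3 has_vector_derivative (\<xi> s \<times> ?D ?e2 s + ?D \<xi> s \<times> ?e2 s)) (at s within I)"
    unfolding frenet3_def[abs_def]
    by (rule bounded_bilinear.has_vector_derivative[OF _ d1[OF s] d2])
       (simp add: bilinear_cross bilinear_conv_bounded_bilinear[symmetric])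
  then have "?D ?e3 s = \<xi> s \<times> ?D ?e2 s + ?D \<xi> s \<times> ?e2 s"
    by (rule deriv_alongI[OF I s])
  also have "\<dots> = - k *\<^sub>R ?e2 s"
    using T(2) by (simp add: f2 e1[OF s] Cross3.right_diff_distrib cross_mult_right cross_mult_left)
  finally have f3: "?D ?e3 s = - k *\<^sub>R ?e2 s" .
  have nz: "?e2 s \<noteq> 0" using n2[OF s] by auto
  have "curvature2 I \<xi> s = k"
    unfolding curvature2_def
    by (rule the_equality) (use f2 f3 nz in auto)
  with f2 f3 show
    "?D ?e2 s = - ?K s *\<^sub>R \<xi> s + curvature2 I \<xi> s *\<^sub>R ?e3 s"
    "?D ?e3 s = - curvature2 I \<xi> s *\<^sub>R ?e2 s"
    by simp_all
qed

end

theory Submission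
  imports Defs
begin

text \<open>
  Write \<open>a\<close>, \<open>b\<close> for the two curvatures and \<open>e2\<close>, \<open>e3\<close> for the second and third frame vectors.
  Differentiating \<open>\<xi>' = a e2\<close> once gives \<open>\<xi>'' = a' e2 - a\<^sup>2 \<xi> + a b e3\<close>. Since \<open>a\<close> and \<open>b\<close>
  do not vanish, this can be solved for
  \<open>e3 = (1/(a b)) \<xi>'' + (1/b) (1/a)' \<xi>' + (a/b) \<xi>\<close> (lemma \<open>frenet3_via_versor\<close>),
  because \<open>(1/a)' = - a'/a\<^sup>2\<close>. Differentiating once more and comparing with the last Frenet-type
  equation \<open>e3' = - b e2 = - (b/a) \<xi>'\<close> gives the claimed equation divided by \<open>a b\<close>
  (lemma \<open>versor_equation\<close>).

  The only analytic point is that the coefficients may be differentiated: \<open>a\<close> must be twice and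
  \<open>b\<close> once differentiable along the interval. The torsion is defined only through a description,
  so its regularity has to come from a formula. Taking inner products of the expression for
  \<open>\<xi>''\<close> with \<open>e2\<close> and \<open>e3\<close> gives \<open>a' = \<xi>'' \<bullet> e2\<close> and \<open>a b = \<xi>'' \<bullet> e3\<close>
  (lemma \<open>frame_coefficients\<close>), whose right-hand sides are differentiable because
  \<open>\<xi>\<close> is smooth and the frame is differentiable.
\<close>

lemma differentiable_deriv_along:
  assumes "f differentiable (at s within I)"
  shows "(f has_vector_derivative deriv_along I f s) (at s within I)"
  using assms by (simp add: deriv_along_def vector_derivative_works)

lemma has_vector_derivative_differentiable:
  assumes "(f has_vector_derivative d) (at s within I)"
  shows "f differentiable (at s within I)"
  using assms by (auto simp: has_vector_derivative_def differentiable_def)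

lemma differentiable_cong_on:
  fixes f g :: "real \<Rightarrow> 'a::real_normed_vector"
  assumes "g differentiable (at s within I)" "s \<in> I" "\<And>t. t \<in> I \<Longrightarrow> f t = g t"
  shows "f differentiable (at s within I)"
  using differentiable_transform_within[OF assms(1) zero_less_one assms(2)] assms(3) by simp

lemma differentiable_inner_within:
  fixes f g :: "real \<Rightarrow> 'a::real_inner"
  assumes "f differentiable (at s within I)" "g differentiable (at s within I)"
  shows "(\<lambda>t. f t \<bullet> g t) differentiable (at s within I)"
  using has_vector_derivative_inner[OF assms[THEN differentiable_deriv_along]]
  by (rule has_vector_derivative_differentiable)

lemma has_vector_derivative_scaleR_along:
  assumes "c differentiable (at s within I)" "(v has_vector_derivative v') (at s within I)"
  shows "((\<lambda>t. c t *\<^sub>R v t) has_vector_derivative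
           (c s *\<^sub>R v' + deriv_along I c s *\<^sub>R v s)) (at s within I)"
  using bounded_bilinear.has_vector_derivative[OF bounded_bilinear_scaleR
      differentiable_deriv_along[OF assms(1)] assms(2)] .

lemma deriv_along_reciprocal:
  fixes f :: "real \<Rightarrow> real"
  assumes "is_interval I" "interior I \<noteq> {}" "s \<in> I"
    and f: "f differentiable (at s within I)" "f s \<noteq> 0"
  shows "deriv_along I (\<lambda>t. 1 / f t) s = - deriv_along I f s / (f s)\<^sup>2"
proof -
  have "(f has_real_derivative deriv_along I f s) (at s within I)"
    using differentiable_deriv_along[OF f(1)]
    by (simp add: has_real_derivative_iff_has_vector_derivative)
  then have "((\<lambda>t. 1 / f t) has_real_derivative - deriv_along I f s / (f s)\<^sup>2) (at s within I)"
    using f(2) by (auto intro!: derivative_eq_intros simp: power2_eq_square)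
  then show ?thesis
    using deriv_alongI[OF assms(1-3)] by (simp add: has_real_derivative_iff_has_vector_derivative)
qed

locale regular_versor_field =
  fixes I :: "real set" and \<xi> :: "real \<Rightarrow> real^3"
  assumes interval: "is_interval I" "interior I \<noteq> {}"
    and versor: "versor_field I \<xi>"
    and curvature1_nonzero: "\<And>s. s \<in> I \<Longrightarrow> curvature1 I \<xi> s \<noteq> 0"
begin

abbreviation "D \<equiv> deriv_along I"
abbreviation "a \<equiv> curvature1 I \<xi>"
abbreviation "b \<equiv> curvature2 I \<xi>"
abbreviation "e2 \<equiv> frenet2 I \<xi>"
abbreviation "e3 \<equiv> frenet3 I \<xi>"

lemmas frenet = frenet_equations[OF interval versor curvature1_nonzero]

lemma versor_derivs:
  assumes "s \<in> I"
  shows "(\<xi> has_vector_derivative D \<xi> s) (at s within I)"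
    and "(D \<xi> has_vector_derivative D (D \<xi>) s) (at s within I)"
    and "(D (D \<xi>) has_vector_derivative D (D (D \<xi>)) s) (at s within I)"
  using smooth_along_has_derivative[of I \<xi> s 0] smooth_along_has_derivative[of I \<xi> s 1]
    smooth_along_has_derivative[of I \<xi> s 2] assms versor
  by (auto simp: versor_field_def numeral_2_eq_2)

lemma curvature1_differentiable:
  assumes s: "s \<in> I"
  shows "a differentiable (at s within I)"
proof -
  have "D \<xi> s \<noteq> 0" using curvature1_nonzero[OF s] by (auto simp: curvature1_def)
  then have "(\<lambda>t. norm (D \<xi> t)) differentiable (at s within I)"
    using differentiable_chain_within[OF
        has_vector_derivative_differentiable[OF versor_derivs(2)[OF s]], of norm]
      differentiable_norm_at
    by (auto simp: o_def intro: differentiable_at_withinI)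
  then show ?thesis by (simp add: curvature1_def[abs_def])
qed

lemma frenet2_differentiable:
  assumes s: "s \<in> I"
  shows "e2 differentiable (at s within I)"
proof -
  have "(\<lambda>t. inverse (a t) *\<^sub>R D \<xi> t) differentiable (at s within I)"
    using curvature1_differentiable[OF s] curvature1_nonzero[OF s]
      has_vector_derivative_differentiable[OF versor_derivs(2)[OF s]]
    by (intro differentiable_scaleR differentiable_inverse) auto
  then show ?thesis by (simp add: frenet2_def[abs_def] divide_inverse)
qed

lemma frenet3_differentiable:
  assumes s: "s \<in> I"
  shows "e3 differentiable (at s within I)"
  unfolding frenet3_def[abs_def]
  by (rule has_vector_derivative_differentiable,
      rule bounded_bilinear.has_vector_derivative[OF _ versor_derivs(1)[OF s]
        differentiable_deriv_along[OF frenet2_differentiable[OF s]]])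
     (simp add: bilinear_cross bilinear_conv_bounded_bilinear[symmetric])

lemma second_derivative:
  assumes s: "s \<in> I"
  shows "D (D \<xi>) s = D a s *\<^sub>R e2 s - (a s)\<^sup>2 *\<^sub>R \<xi> s + (a s * b s) *\<^sub>R e3 s"
proof -
  have "((\<lambda>t. a t *\<^sub>R e2 t) has_vector_derivative
          (a s *\<^sub>R D e2 s + D a s *\<^sub>R e2 s)) (at s within I)"
    by (intro has_vector_derivative_scaleR_along curvature1_differentiable
        differentiable_deriv_along frenet2_differentiable s)
  then have "(D \<xi> has_vector_derivative (a s *\<^sub>R D e2 s + D a s *\<^sub>R e2 s)) (at s within I)"
    by (rule has_vector_derivative_transform[rotated 2]) (use s frenet(1) in auto)
  then have "D (D \<xi>) s = a s *\<^sub>R D e2 s + D a s *\<^sub>R e2 s"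
    by (rule deriv_alongI[OF interval s])
  then show ?thesis
    by (simp add: frenet(2)[OF _ s] algebra_simps power2_eq_square)
qed

text \<open>
  Orthonormality of the frame isolates the coefficients in the expansion of \<open>\<xi>''\<close>. The right-hand
  sides involve no derivative of \<open>e2\<close> or \<open>e3\<close>, so that differentiability of these two vectors
  is enough to differentiate \<open>a'\<close> and \<open>b\<close>.
\<close>

lemma frame_coefficients:
  assumes s: "s \<in> I"
  shows "D a s = D (D \<xi>) s \<bullet> e2 s" and "a s * b s = D (D \<xi>) s \<bullet> e3 s"
proof -
  have un: "\<xi> t \<bullet> \<xi> t = 1" if "t \<in> I" for t
    using versor that by (auto simp: versor_field_def norm_eq_1)
  have n2: "e2 s \<bullet> e2 s = 1"
    using curvature1_nonzero[OF s]
    by (simp add: frenet2_def curvature1_def dot_square_norm power2_eq_square)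
  have "\<xi> s \<bullet> D \<xi> s + D \<xi> s \<bullet> \<xi> s = 0"
    by (rule constant_has_derivative_0[OF interval s
          has_vector_derivative_inner[OF versor_derivs(1)[OF s] versor_derivs(1)[OF s]]])
       (use un in auto)
  then have o12: "\<xi> s \<bullet> e2 s = 0" by (simp add: frenet2_def inner_commute)
  have n3: "e3 s \<bullet> e3 s = 1"
    using orthonormal_triple_expand(3)[OF un[OF s] n2 o12] by (simp add: frenet3_def)
  have o3: "\<xi> s \<bullet> e3 s = 0" "e2 s \<bullet> e3 s = 0" "e3 s \<bullet> e2 s = 0"
    by (simp_all add: frenet3_def dot_cross_self)
  show "D a s = D (D \<xi>) s \<bullet> e2 s" "a s * b s = D (D \<xi>) s \<bullet> e3 s"
    using n2 n3 o12 o3 by (simp_all add: second_derivative[OF s] inner_simps)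
qed

lemma curvature1_deriv_differentiable:
  assumes s: "s \<in> I"
  shows "D a differentiable (at s within I)"
  using differentiable_inner_within[OF
      has_vector_derivative_differentiable[OF versor_derivs(3)[OF s]] frenet2_differentiable[OF s]]
    s frame_coefficients(1)
  by (rule differentiable_cong_on)

lemma curvature2_differentiable:
  assumes s: "s \<in> I"
  shows "b differentiable (at s within I)"
proof (rule differentiable_cong_on)
  show "(\<lambda>t. (D (D \<xi>) t \<bullet> e3 t) / a t) differentiable (at s within I)"
    by (intro differentiable_divide differentiable_inner_within curvature1_differentiable
        frenet3_differentiable has_vector_derivative_differentiable[OF versor_derivs(3)]
        curvature1_nonzero s)
  show "b t = (D (D \<xi>) t \<bullet> e3 t) / a t" if "t \<in> I" for t
    using frame_coefficients(2)[OF that] curvature1_nonzero[OF that] by (simp add: field_simps)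
qed (fact s)

lemma frenet3_via_versor:
  assumes s: "s \<in> I" and b: "b s \<noteq> 0"
  shows "e3 s = (1 / (a s * b s)) *\<^sub>R D (D \<xi>) s
           + (1 / b s * D (\<lambda>u. 1 / a u) s) *\<^sub>R D \<xi> s + (a s / b s) *\<^sub>R \<xi> s"
proof -
  note a = curvature1_nonzero[OF s]
  show ?thesis
    using a b
    by (simp add: second_derivative[OF s] frenet(1)[OF _ s]
        deriv_along_reciprocal[OF interval s curvature1_differentiable[OF s] a]
        algebra_simps power2_eq_square)
qed

text \<open>
  The derivative of the right-hand side of \<open>frenet3_via_versor\<close> must equal \<open>- b e2\<close>; multiplying
  by \<open>a b\<close> makes the coefficient of the third derivative of \<open>\<xi>\<close> equal to \<open>1\<close>.
\<close>

lemma versor_equation: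
  assumes b: "\<And>t. t \<in> I \<Longrightarrow> b t \<noteq> 0" and s: "s \<in> I"
  shows "D (D (D \<xi>)) s
    - (D (\<lambda>t. a t * b t) s / (a s * b s) + D a s / a s) *\<^sub>R D (D \<xi>) s
    + (a s * b s * D (\<lambda>t. 1 / b t * D (\<lambda>u. 1 / a u) t) s + (a s)\<^sup>2 + (b s)\<^sup>2) *\<^sub>R D \<xi> s
    + (a s * b s * D (\<lambda>t. a t / b t) s) *\<^sub>R \<xi> s = 0"
proof -
  define p q w where "p = (\<lambda>t. 1 / (a t * b t))" and "q = (\<lambda>t. 1 / b t * D (\<lambda>u. 1 / a u) t)"
    and "w = (\<lambda>t. a t / b t)"
  note nz = curvature1_nonzero[OF s] b[OF s]
  note da = curvature1_differentiable[OF s] and db = curvature2_differentiable[OF s]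
  have dab: "(\<lambda>t. a t * b t) differentiable (at s within I)"
    using da db by (rule differentiable_mult)
  have dp: "p differentiable (at s within I)"
    unfolding p_def using dab nz by (intro differentiable_divide) auto
  have dw: "w differentiable (at s within I)"
    unfolding w_def using da db nz by (intro differentiable_divide)
  \<comment> \<open>\<open>q\<close> contains the derivative of \<open>1/a\<close>, which agrees with \<open>- a'/a\<^sup>2\<close> on the whole interval;
    this is where the second derivative of \<open>a\<close> is needed.\<close>
  have "(\<lambda>t. 1 / b t * (- D a t / (a t)\<^sup>2)) differentiable (at s within I)"
    using da db nz curvature1_deriv_differentiable[OF s]
    by (intro differentiable_mult differentiable_divide differentiable_minus differentiable_power)
       auto
  then have dq: "q differentiable (at s within I)"
    by (rule differentiable_cong_on)
       (simp_all add: s q_def deriv_along_reciprocal[OF interval] curvature1_differentiable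
         curvature1_nonzero)
  have "((\<lambda>t. p t *\<^sub>R D (D \<xi>) t + q t *\<^sub>R D \<xi> t + w t *\<^sub>R \<xi> t) has_vector_derivative
      (p s *\<^sub>R D (D (D \<xi>)) s + D p s *\<^sub>R D (D \<xi>) s) + (q s *\<^sub>R D (D \<xi>) s + D q s *\<^sub>R D \<xi> s)
      + (w s *\<^sub>R D \<xi> s + D w s *\<^sub>R \<xi> s)) (at s within I)"
    by (intro has_vector_derivative_add has_vector_derivative_scaleR_along dp dq dw
        versor_derivs s)
  then have "(e3 has_vector_derivative
      (p s *\<^sub>R D (D (D \<xi>)) s + D p s *\<^sub>R D (D \<xi>) s) + (q s *\<^sub>R D (D \<xi>) s + D q s *\<^sub>R D \<xi> s)
      + (w s *\<^sub>R D \<xi> s + D w s *\<^sub>R \<xi> s)) (at s within I)"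
    by (rule has_vector_derivative_transform[rotated 2])
       (simp_all add: s b frenet3_via_versor p_def q_def w_def)
  then have "D e3 s = (p s *\<^sub>R D (D (D \<xi>)) s + D p s *\<^sub>R D (D \<xi>) s)
      + (q s *\<^sub>R D (D \<xi>) s + D q s *\<^sub>R D \<xi> s) + (w s *\<^sub>R D \<xi> s + D w s *\<^sub>R \<xi> s)"
    by (rule deriv_alongI[OF interval s])
  moreover have "D e3 s = - (b s / a s) *\<^sub>R D \<xi> s"
    using nz by (simp add: frenet(1,3)[OF _ s])
  ultimately have "0 = (a s * b s) *\<^sub>R
      ((p s *\<^sub>R D (D (D \<xi>)) s + D p s *\<^sub>R D (D \<xi>) s) + (q s *\<^sub>R D (D \<xi>) s + D q s *\<^sub>R D \<xi> s)
       + (w s *\<^sub>R D \<xi> s + D w s *\<^sub>R \<xi> s) + (b s / a s) *\<^sub>R D \<xi> s)"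
    by (metis add.left_inverse scaleR_minus_left scaleR_zero_right)
  also have "\<dots> = (a s * b s * p s) *\<^sub>R D (D (D \<xi>)) s
      + (a s * b s * (D p s + q s)) *\<^sub>R D (D \<xi>) s
      + (a s * b s * (D q s + w s + b s / a s)) *\<^sub>R D \<xi> s + (a s * b s * D w s) *\<^sub>R \<xi> s"
    by (simp add: algebra_simps)
  also have "a s * b s * p s = 1" using nz by (simp add: p_def)
  also have "a s * b s * (D p s + q s) = - (D (\<lambda>t. a t * b t) s / (a s * b s) + D a s / a s)"
  proof -
    have dps: "D p s = - D (\<lambda>t. a t * b t) s / (a s * b s)\<^sup>2"
      unfolding p_def using nz by (intro deriv_along_reciprocal interval s dab) auto
    have qs: "q s = - D a s / ((a s)\<^sup>2 * b s)"
      unfolding q_def deriv_along_reciprocal[OF interval s da nz(1)] by simp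
    show ?thesis
      unfolding dps qs using nz by (simp add: field_simps power2_eq_square)
  qed
  also have "a s * b s * (D q s + w s + b s / a s) = a s * b s * D q s + (a s)\<^sup>2 + (b s)\<^sup>2"
    using nz by (simp add: w_def field_simps power2_eq_square)
  finally show ?thesis by (simp add: q_def w_def algebra_simps)
qed

end

theorem theorem19:
  fixes I :: "real set" and r \<xi> :: "real \<Rightarrow> real^3" and \<pi> :: "real \<Rightarrow> (real^3) set"
    and K1 K2 :: "real \<Rightarrow> real"
  assumes "myller_configuration I r \<xi> \<pi>"
    and "K1 = curvature1 I \<xi>" and "K2 = curvature2 I \<xi>"
    and "\<forall>s\<in>I. K1 s \<noteq> 0" and "\<forall>s\<in>I. K2 s \<noteq> 0"
  shows "\<forall>s\<in>I.
    (deriv_along I ^^ 3) \<xi> s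
    - (deriv_along I (\<lambda>t. K1 t * K2 t) s / (K1 s * K2 s) + deriv_along I K1 s / K1 s)
        *\<^sub>R (deriv_along I ^^ 2) \<xi> s
    + (K1 s * K2 s * deriv_along I (\<lambda>t. 1 / K2 t * deriv_along I (\<lambda>u. 1 / K1 u) t) s
        + (K1 s)\<^sup>2 + (K2 s)\<^sup>2) *\<^sub>R deriv_along I \<xi> s
    + (K1 s * K2 s * deriv_along I (\<lambda>t. K1 t / K2 t) s) *\<^sub>R \<xi> s = 0"
proof -
  have "is_interval I" "interior I \<noteq> {}" "versor_field I \<xi>"
    using assms(1) by (auto simp: myller_configuration_def arclength_curve_def)
  then interpret regular_versor_field I \<xi>
    using assms(2,4) by unfold_locales auto
  show ?thesis
    using versor_equation assms(2,3,5) by (simp add: numeral_2_eq_2 numeral_3_eq_3)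
qed

end
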